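(* Let $\ell$ be an odd prime, fix $\log_\ell$, a countably infinite set $\Omega$ and a function $f: \Omega \to \mathbb{Z}_{\geq 1} \cup \{\infty\}$ with $|f^{-1}(\infty)| = 2$, and suppose that $f^{-1}(n)$ is infinite for every $n \in \mathbb{Z}_{\geq 1}$. Then, with respect to the Haar probability measure on the space of decorated graphs with first two coordinates $(\Omega, f)$ described in the context, the decorated graph $(\Omega, f, g, \lambda)$ is Rado with probability $1$. In particular, two independently randomly selected such decorated graphs are isomorphic with probability $1$.
   Context: Fix an odd prime $\ell$ and an isomorphism of free rank-one $\mathbb{Z}_\ell$-modules $\log_\ell: 1 + \ell\mathbb{Z}_\ell \to \mathbb{Z}_\ell$; $\log_\ell(1 + \ell\alpha) \bmod \ell^n$ depends only on $\alpha \bmod \ell^n$. Write $\mathbb{Z}/\ell^\infty\mathbb{Z} := \mathbb{Z}_\ell$. A decorated graph is a tuple $(\Omega, f, g, \lambda)$ where: $\Omega$ is countably infinite; $f: \Omega \to \mathbb{Z}_{\geq 1} \cup \{\infty\}$ with $f^{-1}(\infty) = \{v_\ell(1), v_\ell(2)\}$ of size $2$, $\Omega_{\mathrm{fin}} := f^{-1}(\mathbb{Z}_{\geq 1})$; $g(v) \in (\mathbb{Z}/\ell^{f(v)}\mathbb{Z})^\ast$ for $v \in \Omega_{\mathrm{fin}}$; $\lambda(v,w) \in \mathbb{Z}/\ell^{f(v,w)}\mathbb{Z}$, $f(v,w) := \min(f(v), f(w))$, for each ordered pair of distinct $v,w$ not both in $\{v_\ell(1), v_\ell(2)\}$, subject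 to $\lambda(v_\ell(1), w) \equiv \log_\ell(1 + g(w)\ell^{f(w)}) \bmod \ell^{f(w)}$ and $\lambda(w, v_\ell(i)) = 0$ for $w \in \Omega_{\mathrm{fin}}$, $i \in \{1,2\}$. Two decorated graphs are isomorphic if there is a bijection of the vertex sets preserving $f$, $g$ and $\lambda$. It is Rado if for every finite $S \subseteq \Omega$ containing $\{v_\ell(1), v_\ell(2)\}$, every $n \geq 1$, $\alpha \in (\mathbb{Z}/\ell^n\mathbb{Z})^\ast$ and elements $\lambda_s(1), \lambda_s(2) \in \mathbb{Z}/\ell^{\min(n, f(s))}\mathbb{Z}$ ($s \in S$) with $\lambda_{v_\ell(1)}(2) \equiv \log_\ell(1 + \alpha\ell^n) \bmod \ell^n$ and $\lambda_{v_\ell(i)}(1) = 0$, there is $v \in \Omega \setminus S$ with $f(v) = n$, $g(v) = \alpha$, $\lambda(v,s) = \lambda_s(1)$ and $\lambda(s,v) = \lambda_s(2)$ for all $s \in S$. Measure: with $(\Omega, f)$ fixed, decorated graphs correspond bijectively to vectors $(g, \lambda)$ in the compact group $\prod_{v \in \Omega_{\mathrm{fin}}} (\mathbb{Z}/\ell^{f(v)}\mathbb{Z})^\ast \times \prod_{(v,w)} \mathbb{Z}/\ell^{f(v,w)}\mathbb{Z}$, where the second product runs over ordered pairs with $v \neq w$, $v \neq v_\ell(1)$ and $w \notin \{v_\ell(1), v_\ell(2)\}$ (all other labels being determined by the constraints); each factor carries the discrete topology, the product the product topology, and the probability is its normalized Haar measure. *)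

theory Defs
  imports
    "HOL-Probability.Probability"
    "HOL-Number_Theory.Residues"
    "HOL-Algebra.Product_Groups"
    "HOL-Library.Extended_Nat"
begin

text \<open>
  An \<open>l\<close>-adic integer is the compatible sequence of its residues: \<open>x n\<close> is the representative
  in \<open>{0..<l ^ n}\<close> of \<open>x\<close> modulo \<open>l ^ n\<close>.
\<close>

type_synonym ladic = "nat \<Rightarrow> int"

definition ladic_ring :: "nat \<Rightarrow> ladic ring" where
  "ladic_ring l =
     \<lparr>carrier = {x. \<forall>n. x n \<in> {0..<int l ^ n} \<and> x (Suc n) mod int l ^ n = x n},
      mult = (\<lambda>x y n. x n * y n mod int l ^ n),
      one = (\<lambda>n. 1 mod int l ^ n),
      zero = (\<lambda>n. 0),
      add = (\<lambda>x y n. (x n + y n) mod int l ^ n)\<rparr>"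

definition ladic_of_int :: "nat \<Rightarrow> int \<Rightarrow> ladic" where
  "ladic_of_int l k = (\<lambda>n. k mod int l ^ n)"

definition principal_units :: "nat \<Rightarrow> ladic monoid" where
  "principal_units l =
     \<lparr>carrier = {\<one>\<^bsub>ladic_ring l\<^esub> \<oplus>\<^bsub>ladic_ring l\<^esub> (ladic_of_int l (int l) \<otimes>\<^bsub>ladic_ring l\<^esub> a) |a.
                   a \<in> carrier (ladic_ring l)},
      mult = mult (ladic_ring l),
      one = one (ladic_ring l)\<rparr>"

text \<open>
  The \<open>l\<close>-adic integers act on the principal units by exponentiation. For \<open>u\<close> congruent to \<open>1\<close>
  modulo \<open>l\<close>, the residue of \<open>u\<close> to the power \<open>k\<close> modulo \<open>l ^ n\<close> depends only on the natural
  number \<open>k\<close> modulo \<open>l ^ n\<close>, so an \<open>l\<close>-adic exponent may be replaced by its \<open>n\<close>-th residue.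
\<close>

definition ladic_power :: "nat \<Rightarrow> ladic \<Rightarrow> ladic \<Rightarrow> ladic" where
  "ladic_power l u a = (\<lambda>n. u n ^ nat (a n) mod int l ^ n)"

definition ladic_log :: "nat \<Rightarrow> (ladic \<Rightarrow> ladic) \<Rightarrow> bool" where
  "ladic_log l L \<longleftrightarrow>
     L \<in> iso (principal_units l) (add_monoid (ladic_ring l)) \<and>
     (\<forall>a\<in>carrier (ladic_ring l). \<forall>u\<in>carrier (principal_units l).
        L (ladic_power l u a) = a \<otimes>\<^bsub>ladic_ring l\<^esub> L u)"

text \<open>
  \<open>L (1 + a l ^ n)\<close> modulo \<open>l ^ n\<close>. This does not depend on the chosen lift of a residue \<open>a\<close>
  modulo \<open>l ^ n\<close>; below \<open>a\<close> is always the representative in \<open>{0..<l ^ n}\<close>.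
\<close>

definition log_label :: "nat \<Rightarrow> (ladic \<Rightarrow> ladic) \<Rightarrow> nat \<Rightarrow> int \<Rightarrow> int" where
  "log_label l L n a = L (ladic_of_int l (1 + a * int l ^ n)) n"

text \<open>
  All labels live modulo finite powers of \<open>l\<close>, so this is only used for finite \<open>n\<close>.
\<close>

definition residues_mod :: "nat \<Rightarrow> enat \<Rightarrow> int ring" where
  "residues_mod l n = residue_ring (int l ^ the_enat n)"

text \<open>
  The two vertices of infinite level are named; the logarithm condition distinguishes them.
\<close>

record 'v decorated_graph =
  verts :: "'v set"
  level :: "'v \<Rightarrow> enat"
  vinf1 :: 'v
  vinf2 :: 'v
  vlabel :: "'v \<Rightarrow> int"
  elabel :: "'v \<times> 'v \<Rightarrow> int"

definition fin_verts :: "'v set \<Rightarrow> ('v \<Rightarrow> enat) \<Rightarrow> 'v set" where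
  "fin_verts V f = {v \<in> V. f v \<noteq> \<infinity>}"

definition label_pairs :: "'v set \<Rightarrow> 'v \<Rightarrow> 'v \<Rightarrow> ('v \<times> 'v) set" where
  "label_pairs V v1 v2 =
     {(v, w). v \<in> V \<and> w \<in> V \<and> v \<noteq> w \<and> \<not> (v \<in> {v1, v2} \<and> w \<in> {v1, v2})}"

definition level_data :: "'v set \<Rightarrow> ('v \<Rightarrow> enat) \<Rightarrow> 'v \<Rightarrow> 'v \<Rightarrow> bool" where
  "level_data V f v1 v2 \<longleftrightarrow>
     countable V \<and> infinite V \<and> (\<forall>v\<in>V. 1 \<le> f v) \<and> v1 \<noteq> v2 \<and> {v \<in> V. f v = \<infinity>} = {v1, v2}"

definition is_decorated_graph :: "nat \<Rightarrow> (ladic \<Rightarrow> ladic) \<Rightarrow> 'v decorated_graph \<Rightarrow> bool" where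
  "is_decorated_graph l L G \<longleftrightarrow>
     level_data (verts G) (level G) (vinf1 G) (vinf2 G) \<and>
     vlabel G \<in> (\<Pi>\<^sub>E v\<in>fin_verts (verts G) (level G). Units (residues_mod l (level G v))) \<and>
     elabel G \<in> (\<Pi>\<^sub>E (v, w)\<in>label_pairs (verts G) (vinf1 G) (vinf2 G).
                    carrier (residues_mod l (min (level G v) (level G w)))) \<and>
     (\<forall>w\<in>fin_verts (verts G) (level G).
        elabel G (vinf1 G, w) = log_label l L (the_enat (level G w)) (vlabel G w) \<and>
        elabel G (w, vinf1 G) = 0 \<and> elabel G (w, vinf2 G) = 0)"

definition decorated_graph_isomorphic :: "'v decorated_graph \<Rightarrow> 'w decorated_graph \<Rightarrow> bool" where
  "decorated_graph_isomorphic G H \<longleftrightarrow>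
     (\<exists>\<phi>. bij_betw \<phi> (verts G) (verts H) \<and>
          (\<forall>v\<in>verts G. level H (\<phi> v) = level G v) \<and>
          (\<forall>v\<in>fin_verts (verts G) (level G). vlabel H (\<phi> v) = vlabel G v) \<and>
          (\<forall>(v, w)\<in>label_pairs (verts G) (vinf1 G) (vinf2 G).
             elabel H (\<phi> v, \<phi> w) = elabel G (v, w)))"

definition is_rado :: "nat \<Rightarrow> (ladic \<Rightarrow> ladic) \<Rightarrow> 'v decorated_graph \<Rightarrow> bool" where
  "is_rado l L G \<longleftrightarrow>
     is_decorated_graph l L G \<and>
     (\<forall>S n \<alpha> lam1 lam2.
        finite S \<and> S \<subseteq> verts G \<and> {vinf1 G, vinf2 G} \<subseteq> S \<and> 1 \<le> n \<and>
        \<alpha> \<in> Units (residues_mod l (enat n)) \<and>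
        (\<forall>s\<in>S. lam1 s \<in> carrier (residues_mod l (min (enat n) (level G s))) \<and>
                lam2 s \<in> carrier (residues_mod l (min (enat n) (level G s)))) \<and>
        lam2 (vinf1 G) = log_label l L n \<alpha> \<and> lam1 (vinf1 G) = 0 \<and> lam1 (vinf2 G) = 0 \<longrightarrow>
        (\<exists>v \<in> verts G - S. level G v = enat n \<and> vlabel G v = \<alpha> \<and>
           (\<forall>s\<in>S. elabel G (v, s) = lam1 s \<and> elabel G (s, v) = lam2 s)))"

definition free_pairs :: "'v set \<Rightarrow> 'v \<Rightarrow> 'v \<Rightarrow> ('v \<times> 'v) set" where
  "free_pairs V v1 v2 = {(v, w). v \<in> V \<and> w \<in> V \<and> v \<noteq> w \<and> v \<noteq> v1 \<and> w \<notin> {v1, v2}}"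

definition vlabel_group :: "nat \<Rightarrow> ('v \<Rightarrow> enat) \<Rightarrow> 'v \<Rightarrow> int monoid" where
  "vlabel_group l f v = units_of (residues_mod l (f v))"

definition elabel_group :: "nat \<Rightarrow> ('v \<Rightarrow> enat) \<Rightarrow> 'v \<times> 'v \<Rightarrow> int monoid" where
  "elabel_group l f = (\<lambda>(v, w). add_monoid (residues_mod l (min (f v) (f w))))"

definition label_group ::
    "nat \<Rightarrow> 'v set \<Rightarrow> ('v \<Rightarrow> enat) \<Rightarrow> 'v \<Rightarrow> 'v \<Rightarrow> (('v \<Rightarrow> int) \<times> ('v \<times> 'v \<Rightarrow> int)) monoid" where
  "label_group l V f v1 v2 =
     product_group (fin_verts V f) (vlabel_group l f) \<times>\<times>
     product_group (free_pairs V v1 v2) (elabel_group l f)"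

definition label_topology ::
    "nat \<Rightarrow> 'v set \<Rightarrow> ('v \<Rightarrow> enat) \<Rightarrow> 'v \<Rightarrow> 'v \<Rightarrow> (('v \<Rightarrow> int) \<times> ('v \<times> 'v \<Rightarrow> int)) topology" where
  "label_topology l V f v1 v2 =
     prod_topology
       (product_topology (\<lambda>v. discrete_topology (carrier (vlabel_group l f v))) (fin_verts V f))
       (product_topology (\<lambda>p. discrete_topology (carrier (elabel_group l f p))) (free_pairs V v1 v2))"

text \<open>
  \<open>M\<close> is the normalized Haar measure on the Borel sets of a compact metrizable group \<open>G\<close> with
  topology \<open>T\<close>. Regularity need not be required, since finite Borel measures on compact metrizable
  spaces are regular.
\<close>

definition normalized_haar_measure ::
    "('a, 'b) monoid_scheme \<Rightarrow> 'a topology \<Rightarrow> 'a measure \<Rightarrow> bool" where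
  "normalized_haar_measure G T M \<longleftrightarrow>
     space M = topspace T \<and> sets M = sigma_sets (topspace T) {U. openin T U} \<and> prob_space M \<and>
     (\<forall>x\<in>carrier G. \<forall>A\<in>sets M. emeasure M ((\<lambda>y. x \<otimes>\<^bsub>G\<^esub> y) ` A) = emeasure M A)"

definition graph_of_labels ::
    "nat \<Rightarrow> (ladic \<Rightarrow> ladic) \<Rightarrow> 'v set \<Rightarrow> ('v \<Rightarrow> enat) \<Rightarrow> 'v \<Rightarrow> 'v \<Rightarrow>
     ('v \<Rightarrow> int) \<times> ('v \<times> 'v \<Rightarrow> int) \<Rightarrow> 'v decorated_graph" where
  "graph_of_labels l L V f v1 v2 x =
     \<lparr>verts = V, level = f, vinf1 = v1, vinf2 = v2, vlabel = fst x,
      elabel = (\<lambda>(v, w)\<in>label_pairs V v1 v2.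
        if w \<in> {v1, v2} then 0
        else if v = v1 then log_label l L (the_enat (f w)) (fst x w)
        else snd x (v, w))\<rparr>"

lemma ladic_of_int_carrier: "l \<ge> 1 \<Longrightarrow> ladic_of_int l k \<in> carrier (ladic_ring l)"
  by (auto simp: ladic_of_int_def ladic_ring_def mod_mod_cancel)

lemma log_label_carrier:
  assumes "l \<ge> 2" "ladic_log l L" "n \<ge> 1"
  shows "log_label l L n a \<in> {0..int l ^ n - 1}"
proof -
  obtain m where m: "n = Suc m"
    using \<open>n \<ge> 1\<close> by (cases n) auto
  have "ladic_of_int l (1 + a * int l ^ n) =
      \<one>\<^bsub>ladic_ring l\<^esub> \<oplus>\<^bsub>ladic_ring l\<^esub>
        (ladic_of_int l (int l) \<otimes>\<^bsub>ladic_ring l\<^esub> ladic_of_int l (a * int l ^ m))"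
    by (auto simp: ladic_of_int_def ladic_ring_def mod_simps m mult_ac)
  moreover have "ladic_of_int l (a * int l ^ m) \<in> carrier (ladic_ring l)"
    using assms by (intro ladic_of_int_carrier) auto
  ultimately have "ladic_of_int l (1 + a * int l ^ n) \<in> carrier (principal_units l)"
    by (auto simp: principal_units_def)
  then have "L (ladic_of_int l (1 + a * int l ^ n)) \<in> carrier (ladic_ring l)"
    using assms(2) by (auto simp: ladic_log_def iso_def hom_def)
  then show ?thesis
    by (auto simp: log_label_def ladic_ring_def)
qed

text \<open>
  Label vectors correspond bijectively to the decorated graphs on \<open>(V, f)\<close>.
\<close>

lemma bij_betw_graph_of_labels:
  assumes l: "l \<ge> 2" and L: "ladic_log l L" and f: "level_data V f v1 v2"
  shows "bij_betw (graph_of_labels l L V f v1 v2) (carrier (label_group l V f v1 v2))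
     {G. is_decorated_graph l L G \<and> verts G = V \<and> level G = f \<and> vinf1 G = v1 \<and> vinf2 G = v2}"
    (is "bij_betw ?\<Gamma> ?A ?B")
proof (rule bij_betw_byWitness[where f' = "\<lambda>G. (vlabel G, restrict (elabel G) (free_pairs V v1 v2))"])
  have inf: "v \<in> V \<and> f v = \<infinity> \<longleftrightarrow> v = v1 \<or> v = v2" for v
    using f by (simp add: level_data_def set_eq_iff)
  have v: "v1 \<in> V" "v2 \<in> V" "v1 \<noteq> v2" "f v1 = \<infinity>" "f v2 = \<infinity>"
    using inf[of v1] inf[of v2] f by (simp_all add: level_data_def)
  have fin: "f v \<noteq> \<infinity> \<longleftrightarrow> v \<noteq> v1 \<and> v \<noteq> v2" if "v \<in> V" for v
    using inf[of v] that by simp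
  have ge: "\<And>v. v \<in> V \<Longrightarrow> 1 \<le> f v"
    using f by (simp add: level_data_def)
  have ge': "1 \<le> the_enat (f w)" if "w \<in> V" "f w \<noteq> \<infinity>" for w
    using ge[OF that(1)] that(2) by (cases "f w") (auto simp: one_enat_def)
  have car: "?A = (\<Pi>\<^sub>E v\<in>fin_verts V f. Units (residues_mod l (f v))) \<times>
     (\<Pi>\<^sub>E (v, w)\<in>free_pairs V v1 v2. carrier (residues_mod l (min (f v) (f w))))"
    by (simp add: label_group_def DirProd_def vlabel_group_def elabel_group_def units_of_def
        product_group_def case_prod_unfold)
  have sub: "free_pairs V v1 v2 \<subseteq> label_pairs V v1 v2"
    by (auto simp: free_pairs_def label_pairs_def)
  show "\<forall>x\<in>?A. (vlabel (?\<Gamma> x), restrict (elabel (?\<Gamma> x)) (free_pairs V v1 v2)) = x"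
  proof
    fix x assume "x \<in> ?A"
    then have "snd x \<in> extensional (free_pairs V v1 v2)"
      by (auto simp: car PiE_def)
    then have "restrict (elabel (?\<Gamma> x)) (free_pairs V v1 v2) = snd x"
      by (intro extensionalityI[of _ "free_pairs V v1 v2"])
        (auto simp: graph_of_labels_def free_pairs_def label_pairs_def)
    then show "(vlabel (?\<Gamma> x), restrict (elabel (?\<Gamma> x)) (free_pairs V v1 v2)) = x"
      by (simp add: graph_of_labels_def)
  qed
  show "\<forall>G\<in>?B. ?\<Gamma> (vlabel G, restrict (elabel G) (free_pairs V v1 v2)) = G"
  proof
    fix G assume G: "G \<in> ?B"
    then have "elabel G \<in> extensional (label_pairs V v1 v2)"
      by (auto simp: is_decorated_graph_def PiE_def)
    moreover have "elabel G (v, w) = (if w \<in> {v1, v2} then 0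
        else if v = v1 then log_label l L (the_enat (f w)) (vlabel G w)
        else restrict (elabel G) (free_pairs V v1 v2) (v, w))"
      if "(v, w) \<in> label_pairs V v1 v2" for v w
      using that G fin v
      by (auto simp: is_decorated_graph_def label_pairs_def free_pairs_def fin_verts_def)
    ultimately have "elabel (?\<Gamma> (vlabel G, restrict (elabel G) (free_pairs V v1 v2))) = elabel G"
      by (intro extensionalityI[of _ "label_pairs V v1 v2"]) (auto simp: graph_of_labels_def)
    then show "?\<Gamma> (vlabel G, restrict (elabel G) (free_pairs V v1 v2)) = G"
      using G by (intro decorated_graph.equality) (auto simp: graph_of_labels_def)
  qed
  show "?\<Gamma> ` ?A \<subseteq> ?B"
  proof clarify
    fix g lam assume x: "(g, lam) \<in> ?A"
    have g: "g \<in> (\<Pi>\<^sub>E v\<in>fin_verts V f. Units (residues_mod l (f v)))"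
      and lam: "\<And>v w. (v, w) \<in> free_pairs V v1 v2 \<Longrightarrow>
          lam (v, w) \<in> carrier (residues_mod l (min (f v) (f w)))"
      using x by (auto simp: car PiE_def Pi_def)
    have "elabel (?\<Gamma> (g, lam)) (v, w) \<in> carrier (residues_mod l (min (f v) (f w)))"
      if p: "(v, w) \<in> label_pairs V v1 v2" for v w
    proof -
      consider "w \<in> {v1, v2}" | "w \<notin> {v1, v2}" "v = v1" | "(v, w) \<in> free_pairs V v1 v2"
        using p by (auto simp: free_pairs_def label_pairs_def)
      then show ?thesis
      proof cases
        case 1
        with l p show ?thesis
          by (auto simp: graph_of_labels_def residues_mod_def residue_ring_def)
      next
        case 2
        then have w: "w \<in> V" "f w \<noteq> \<infinity>"
          using p fin by (auto simp: label_pairs_def)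
        have "log_label l L (the_enat (f w)) (g w) \<in> carrier (residues_mod l (f w))"
          using log_label_carrier[OF l L ge'[OF w]] by (simp add: residues_mod_def residue_ring_def)
        with 2 p v show ?thesis
          by (auto simp: graph_of_labels_def)
      next
        case 3
        with p lam[OF 3] show ?thesis
          by (auto simp: graph_of_labels_def free_pairs_def)
      qed
    qed
    then have e: "elabel (?\<Gamma> (g, lam)) \<in> (\<Pi>\<^sub>E (v, w)\<in>label_pairs V v1 v2.
                    carrier (residues_mod l (min (f v) (f w))))"
      by (auto simp: PiE_def Pi_def) (simp add: graph_of_labels_def)
    have "elabel (?\<Gamma> (g, lam)) (v1, w) = log_label l L (the_enat (f w)) (g w) \<and>
        elabel (?\<Gamma> (g, lam)) (w, v1) = 0 \<and> elabel (?\<Gamma> (g, lam)) (w, v2) = 0"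
      if "w \<in> fin_verts V f" for w
      using that fin v by (auto simp: graph_of_labels_def fin_verts_def label_pairs_def)
    with g e f show "is_decorated_graph l L (?\<Gamma> (g, lam)) \<and> verts (?\<Gamma> (g, lam)) = V \<and>
        level (?\<Gamma> (g, lam)) = f \<and> vinf1 (?\<Gamma> (g, lam)) = v1 \<and> vinf2 (?\<Gamma> (g, lam)) = v2"
      unfolding is_decorated_graph_def by (simp add: graph_of_labels_def)
  qed
  show "(\<lambda>G. (vlabel G, restrict (elabel G) (free_pairs V v1 v2))) ` ?B \<subseteq> ?A"
    using sub unfolding car is_decorated_graph_def by (fastforce simp: PiE_def Pi_def)
qed

end

theory Submission
  imports Defs
begin

text \<open>
  For a finite set \<open>S\<close> and prescribed labels, each of infinitely many vertices of level \<open>n\<close> outside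
  \<open>S\<close> realizes these labels with the same positive probability, and independently, since
  different vertices involve disjoint sets of coordinates. Hence some vertex does so almost
  surely, and there are only countably many choices of \<open>S\<close>, \<open>n\<close> and labels. Two Rado graphs
  are isomorphic by a back-and-forth argument.
\<close>

subsection \<open>Cylinders in products of finite groups\<close>

text \<open>The measure is given only by translation invariance on the Borel sets and is never
  identified with a product measure, so independence is replaced by counting. If an event
  \<open>A\<close> ignores finitely many coordinates with finite groups, translations in these
  coordinates preserve \<open>A\<close> and permute the cylinders over them, so these cylinders cut
  \<open>A\<close> into equal shares. If there are at most \<open>N\<close> cylinders, a prescribed
  one takes at least 1/N of \<open>A\<close>, and missing k prescribed ones over disjoint
  coordinates has probability at most (1 - 1/N)^k. This calls for an \<open>N\<close> that is the
  same for all candidate vertices: every label at a vertex of level n lives modulo a divisor of l^n,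
  and at most 2|S| random labels join it to \<open>S\<close>. Labels towards the vertices of
  infinite level, and from the first of these, are determined rather than random. The side
  conditions of the Rado property make the prescribed values agree with them. Every decorated graph
  satisfies the same conditions, which is why a vertex of one graph can always be requested in the
  other.\<close>

lemma product_group_translation:
  assumes G: "\<And>i. i \<in> I \<Longrightarrow> group (G i)"
    and J: "J \<subseteq> I"
    and p: "\<And>i. i \<in> J \<Longrightarrow> p i \<in> carrier (G i)" and q: "\<And>i. i \<in> J \<Longrightarrow> q i \<in> carrier (G i)"
  shows "\<exists>t\<in>carrier (product_group I G). \<forall>x\<in>carrier (product_group I G).
           (\<forall>i\<in>J. x i = p i) \<longrightarrow> t \<otimes>\<^bsub>product_group I G\<^esub> x = override_on x q J"
proof (intro bexI ballI impI)
  \<comment> \<open>Left multiplication by q p^(-1) turns the value p into q, and the trivial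
    entries leave all other coordinates alone.\<close>
  let ?t = "(\<lambda>i\<in>I. if i \<in> J then q i \<otimes>\<^bsub>G i\<^esub> inv\<^bsub>G i\<^esub> p i else \<one>\<^bsub>G i\<^esub>)"
  fix x assume x: "x \<in> carrier (product_group I G)" and eq: "\<forall>i\<in>J. x i = p i"
  show "?t \<otimes>\<^bsub>product_group I G\<^esub> x = override_on x q J"
  proof
    fix i
    show "(?t \<otimes>\<^bsub>product_group I G\<^esub> x) i = override_on x q J i"
    proof (cases "i \<in> I")
      case True
      interpret group "G i"
        using G True by blast
      have "x i \<in> carrier (G i)"
        using x True by auto
      then show ?thesis
        using True p[of i] q[of i] bspec[OF eq, of i]
        by (cases "i \<in> J") (simp_all add: m_assoc)
    next
      case False
      then show ?thesis
        using J x by (auto simp: PiE_def extensional_def override_on_def)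
    qed
  qed
next
  show "(\<lambda>i\<in>I. if i \<in> J then q i \<otimes>\<^bsub>G i\<^esub> inv\<^bsub>G i\<^esub> p i else \<one>\<^bsub>G i\<^esub>) \<in> carrier (product_group I G)"
    using G p q J by (auto simp: group.is_monoid intro!: monoid.m_closed group.inv_closed monoid.one_closed)
qed

text \<open>Vertex labels and edge labels have different index types, hence two products side by
  side. The arithmetic of the residue rings is hidden: only the group structure of the factors and
  the invariance of \<open>M\<close> are visible here.\<close>

locale product_haar =
  fixes I :: "'i set" and G :: "'i \<Rightarrow> 'a monoid" and I' :: "'j set" and G' :: "'j \<Rightarrow> 'b monoid"
    and M :: "(('i \<Rightarrow> 'a) \<times> ('j \<Rightarrow> 'b)) measure"
  assumes group: "\<And>i. i \<in> I \<Longrightarrow> group (G i)" and group': "\<And>i. i \<in> I' \<Longrightarrow> group (G' i)"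
    and haar: "normalized_haar_measure (product_group I G \<times>\<times> product_group I' G')
      (prod_topology (product_topology (\<lambda>i. discrete_topology (carrier (G i))) I)
        (product_topology (\<lambda>i. discrete_topology (carrier (G' i))) I')) M"

sublocale product_haar \<subseteq> prob_space M
  using haar by (simp add: normalized_haar_measure_def)

context product_haar
begin

text \<open>\<open>q\<close> and \<open>q'\<close> are total functions read only on \<open>J\<close>
  and \<open>J'\<close>, so that one fixed pair of functions can describe a whole sequence of
  cylinders over varying coordinates.\<close>

definition cylinder :: "'i set \<Rightarrow> 'j set \<Rightarrow> ('i \<Rightarrow> 'a) \<Rightarrow> ('j \<Rightarrow> 'b) \<Rightarrow> (('i \<Rightarrow> 'a) \<times> ('j \<Rightarrow> 'b)) set" where
  "cylinder J J' q q' = {x \<in> space M. (\<forall>i\<in>J. fst x i = q i) \<and> (\<forall>i\<in>J'. snd x i = q' i)}"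

lemma space_eq: "space M = (\<Pi>\<^sub>E i\<in>I. carrier (G i)) \<times> (\<Pi>\<^sub>E i\<in>I'. carrier (G' i))"
  using haar by (simp add: normalized_haar_measure_def)

lemma translation_invariant:
  assumes "s \<in> carrier (product_group I G)" "t \<in> carrier (product_group I' G')" "A \<in> sets M"
  shows "emeasure M ((\<lambda>x. (s \<otimes>\<^bsub>product_group I G\<^esub> fst x, t \<otimes>\<^bsub>product_group I' G'\<^esub> snd x)) ` A) = emeasure M A"
proof -
  have "emeasure M ((\<lambda>x. (s, t) \<otimes>\<^bsub>product_group I G \<times>\<times> product_group I' G'\<^esub> x) ` A) = emeasure M A"
    using haar assms by (simp add: normalized_haar_measure_def DirProd_def)
  then show ?thesis
    by (simp add: DirProd_def case_prod_unfold)
qed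

lemma open_in_sets:
  assumes "openin (prod_topology (product_topology (\<lambda>i. discrete_topology (carrier (G i))) I)
        (product_topology (\<lambda>i. discrete_topology (carrier (G' i))) I')) U"
  shows "U \<in> sets M"
  using haar assms by (auto simp: normalized_haar_measure_def)

lemma coordinate_sets:
  assumes "i \<in> I"
  shows "{x \<in> space M. fst x i = a} \<in> sets M"
proof -
  let ?T = "product_topology (\<lambda>i. discrete_topology (carrier (G i))) I"
  let ?T' = "product_topology (\<lambda>i. discrete_topology (carrier (G' i))) I'"
  have "continuous_map (prod_topology ?T ?T') (discrete_topology (carrier (G i))) ((\<lambda>x. x i) \<circ> fst)"
    using assms by (intro continuous_map_compose[OF continuous_map_fst]
        continuous_map_product_projection[of i I "\<lambda>i. discrete_topology (carrier (G i))"]) auto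
  \<comment> \<open>The intersection with the carrier is open in the discrete topology for every
    \<open>a\<close>; when \<open>a\<close> lies outside the carrier, the preimage is empty on both
    sides of the equation below.\<close>
  from openin_continuous_map_preimage[OF this, of "{a} \<inter> carrier (G i)"]
  have "{x \<in> space M. x \<in> space M \<and> fst x i \<in> {a} \<inter> carrier (G i)} \<in> sets M"
    by (intro open_in_sets) (simp add: space_eq)
  also have "{x \<in> space M. x \<in> space M \<and> fst x i \<in> {a} \<inter> carrier (G i)} = {x \<in> space M. fst x i = a}"
    using assms by (auto simp: space_eq)
  finally show ?thesis .
qed

lemma coordinate_sets':
  assumes "i \<in> I'"
  shows "{x \<in> space M. snd x i = a} \<in> sets M"
proof -
  let ?T = "product_topology (\<lambda>i. discrete_topology (carrier (G i))) I"
  let ?T' = "product_topology (\<lambda>i. discrete_topology (carrier (G' i))) I'"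
  have "continuous_map (prod_topology ?T ?T') (discrete_topology (carrier (G' i))) ((\<lambda>x. x i) \<circ> snd)"
    using assms by (intro continuous_map_compose[OF continuous_map_snd]
        continuous_map_product_projection[of i I' "\<lambda>i. discrete_topology (carrier (G' i))"]) auto
  from openin_continuous_map_preimage[OF this, of "{a} \<inter> carrier (G' i)"]
  have "{x \<in> space M. x \<in> space M \<and> snd x i \<in> {a} \<inter> carrier (G' i)} \<in> sets M"
    by (intro open_in_sets) (simp add: space_eq)
  also have "{x \<in> space M. x \<in> space M \<and> snd x i \<in> {a} \<inter> carrier (G' i)} = {x \<in> space M. snd x i = a}"
    using assms by (auto simp: space_eq)
  finally show ?thesis .
qed

lemma cylinder_sets:
  assumes "J \<subseteq> I" "J' \<subseteq> I'" "finite J" "finite J'"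
  shows "cylinder J J' q q' \<in> sets M"
  unfolding cylinder_def using assms coordinate_sets coordinate_sets'
  by (intro sets.sets_Collect_conj sets.sets_Collect_finite_All) auto

text \<open>\<open>inv\<close> expresses that membership in \<open>A\<close> ignores the coordinates
  in \<open>J\<close> and \<open>J'\<close>. A translation that changes only these coordinates
  therefore carries one intersection onto the other, and invariance of the measure gives
  equality.\<close>

lemma prob_Int_cylinder_eq:
  assumes J: "J \<subseteq> I" "J' \<subseteq> I'" "finite J" "finite J'"
    and p: "\<And>i. i \<in> J \<Longrightarrow> p i \<in> carrier (G i)" "\<And>i. i \<in> J' \<Longrightarrow> p' i \<in> carrier (G' i)"
    and q: "\<And>i. i \<in> J \<Longrightarrow> q i \<in> carrier (G i)" "\<And>i. i \<in> J' \<Longrightarrow> q' i \<in> carrier (G' i)"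
    and A: "A \<in> sets M"
    and inv: "\<And>x r r'. \<lbrakk>x \<in> A; \<And>i. i \<in> J \<Longrightarrow> r i \<in> carrier (G i); \<And>i. i \<in> J' \<Longrightarrow> r' i \<in> carrier (G' i)\<rbrakk>
                 \<Longrightarrow> (override_on (fst x) r J, override_on (snd x) r' J') \<in> A"
  shows "prob (A \<inter> cylinder J J' q q') = prob (A \<inter> cylinder J J' p p')"
proof -
  have "\<exists>s\<in>carrier (product_group I G). \<forall>x\<in>carrier (product_group I G).
      (\<forall>i\<in>J. x i = p i) \<longrightarrow> s \<otimes>\<^bsub>product_group I G\<^esub> x = override_on x q J"
    by (rule product_group_translation) (fact group J p q)+
  then obtain s where s: "s \<in> carrier (product_group I G)"
    and s_eq: "\<forall>x\<in>carrier (product_group I G). (\<forall>i\<in>J. x i = p i) \<longrightarrow>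
           s \<otimes>\<^bsub>product_group I G\<^esub> x = override_on x q J" ..
  have "\<exists>t\<in>carrier (product_group I' G'). \<forall>x\<in>carrier (product_group I' G').
      (\<forall>i\<in>J'. x i = p' i) \<longrightarrow> t \<otimes>\<^bsub>product_group I' G'\<^esub> x = override_on x q' J'"
    by (rule product_group_translation) (fact group' J p q)+
  then obtain t where t: "t \<in> carrier (product_group I' G')"
    and t_eq: "\<forall>x\<in>carrier (product_group I' G'). (\<forall>i\<in>J'. x i = p' i) \<longrightarrow>
           t \<otimes>\<^bsub>product_group I' G'\<^esub> x = override_on x q' J'" ..
  let ?ov = "\<lambda>r r' x. (override_on (fst x) r J, override_on (snd x) r' J')"
  have sp: "x \<in> space M" if "x \<in> A" for x
    using that A sets.sets_into_space by blast
  \<comment> \<open>Overwriting replaces the translation at first because its inverse is plain: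
    overwriting with \<open>p\<close> and \<open>p'\<close> is undone on the cylinder by overwriting
    with \<open>q\<close> and \<open>q'\<close>.\<close>
  have "A \<inter> cylinder J J' q q' = ?ov q q' ` (A \<inter> cylinder J J' p p')"
  proof (intro equalityI subsetI)
    fix x assume x: "x \<in> A \<inter> cylinder J J' q q'"
    have "?ov p p' x \<in> A"
      using x inv[of x p p'] p by simp
    moreover from this have "?ov p p' x \<in> cylinder J J' p p'"
      using sp by (auto simp: cylinder_def)
    moreover have "x = ?ov q q' (?ov p p' x)"
      using x by (auto simp: cylinder_def override_on_def fun_eq_iff prod_eq_iff)
    ultimately show "x \<in> ?ov q q' ` (A \<inter> cylinder J J' p p')"
      by (intro image_eqI IntI)
  next
    fix y assume "y \<in> ?ov q q' ` (A \<inter> cylinder J J' p p')"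
    then obtain x where x: "x \<in> A" "y = ?ov q q' x"
      by blast
    then have "y \<in> A"
      using inv[of x q q'] q by simp
    then show "y \<in> A \<inter> cylinder J J' q q'"
      using sp x by (auto simp: cylinder_def)
  qed
  also have "\<dots> = (\<lambda>x. (s \<otimes>\<^bsub>product_group I G\<^esub> fst x, t \<otimes>\<^bsub>product_group I' G'\<^esub> snd x)) ` (A \<inter> cylinder J J' p p')"
    by (intro image_cong refl) (simp add: cylinder_def space_eq mem_Times_iff s_eq t_eq del: mult_product_group)
  finally have "emeasure M (A \<inter> cylinder J J' q q') = emeasure M (A \<inter> cylinder J J' p p')"
    using translation_invariant[OF s t, of "A \<inter> cylinder J J' p p'"] A cylinder_sets[OF J] by auto
  then show ?thesis
    by (simp add: measure_def)
qed

text \<open>The value assignments on \<open>J\<close> and \<open>J'\<close> cover \<open>A\<close>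
  by equally probable pieces, and the product of the group orders counts these assignments.\<close>

lemma prob_le_card_mult_cylinder:
  assumes J: "J \<subseteq> I" "J' \<subseteq> I'" "finite J" "finite J'"
    and fin: "\<And>i. i \<in> J \<Longrightarrow> finite (carrier (G i))" "\<And>i. i \<in> J' \<Longrightarrow> finite (carrier (G' i))"
    and p: "\<And>i. i \<in> J \<Longrightarrow> p i \<in> carrier (G i)" "\<And>i. i \<in> J' \<Longrightarrow> p' i \<in> carrier (G' i)"
    and A: "A \<in> sets M"
    and inv: "\<And>x r r'. \<lbrakk>x \<in> A; \<And>i. i \<in> J \<Longrightarrow> r i \<in> carrier (G i); \<And>i. i \<in> J' \<Longrightarrow> r' i \<in> carrier (G' i)\<rbrakk>
                 \<Longrightarrow> (override_on (fst x) r J, override_on (snd x) r' J') \<in> A"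
  shows "prob A \<le> real ((\<Prod>i\<in>J. card (carrier (G i))) * (\<Prod>i\<in>J'. card (carrier (G' i)))) *
           prob (A \<inter> cylinder J J' p p')"
proof -
  let ?Q = "(\<Pi>\<^sub>E i\<in>J. carrier (G i)) \<times> (\<Pi>\<^sub>E i\<in>J'. carrier (G' i))"
  have finQ: "finite ?Q"
    using J fin by (intro finite_cartesian_product finite_PiE) auto
  have "A \<subseteq> (\<Union>q\<in>?Q. A \<inter> cylinder J J' (fst q) (snd q))"
  proof
    fix x assume x: "x \<in> A"
    then have "x \<in> space M"
      using A sets.sets_into_space by blast
    then have "(restrict (fst x) J, restrict (snd x) J') \<in> ?Q" 
      and "x \<in> cylinder J J' (restrict (fst x) J) (restrict (snd x) J')"
      using J by (auto simp: space_eq cylinder_def)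
    then show "x \<in> (\<Union>q\<in>?Q. A \<inter> cylinder J J' (fst q) (snd q))"
      using x by force
  qed
  then have "prob A \<le> prob (\<Union>q\<in>?Q. A \<inter> cylinder J J' (fst q) (snd q))"
    using A cylinder_sets[OF J] finQ by (intro finite_measure_mono sets.finite_UN) auto
  also have "\<dots> \<le> (\<Sum>q\<in>?Q. prob (A \<inter> cylinder J J' (fst q) (snd q)))"
    using A cylinder_sets[OF J] finQ by (intro finite_measure_subadditive_finite) auto
  also have "\<dots> = (\<Sum>q\<in>?Q. prob (A \<inter> cylinder J J' p p'))"
    by (intro sum.cong refl prob_Int_cylinder_eq[OF J p _ _ A inv]) auto
  also have "\<dots> = real (card ?Q) * prob (A \<inter> cylinder J J' p p')"
    by simp
  also have "card ?Q = (\<Prod>i\<in>J. card (carrier (G i))) * (\<Prod>i\<in>J'. card (carrier (G' i)))"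
    using J by (simp add: card_cartesian_product card_PiE)
  finally show ?thesis .
qed

text \<open>
  The event of missing the first \<open>k\<close> cylinders does not involve the coordinates in \<open>J k\<close>, so
  hitting the next one has conditional probability at least \<open>1 / N\<close>.
\<close>

lemma AE_ex_cylinder:
  fixes J :: "nat \<Rightarrow> 'i set" and J' :: "nat \<Rightarrow> 'j set"
  assumes J: "\<And>k. J k \<subseteq> I" "\<And>k. J' k \<subseteq> I'" "\<And>k. finite (J k)" "\<And>k. finite (J' k)"
    and disj: "disjoint_family J" "disjoint_family J'"
    and fin: "\<And>k i. i \<in> J k \<Longrightarrow> finite (carrier (G i))" "\<And>k i. i \<in> J' k \<Longrightarrow> finite (carrier (G' i))"
    and p: "\<And>k i. i \<in> J k \<Longrightarrow> p i \<in> carrier (G i)" "\<And>k i. i \<in> J' k \<Longrightarrow> p' i \<in> carrier (G' i)"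
    and N: "\<And>k. (\<Prod>i\<in>J k. card (carrier (G i))) * (\<Prod>i\<in>J' k. card (carrier (G' i))) \<le> N"
  shows "AE x in M. \<exists>k. x \<in> cylinder (J k) (J' k) p p'"
proof -
  let ?C = "\<lambda>k. cylinder (J k) (J' k) p p'"
  define A where "A k = space M - (\<Union>i<k. ?C i)" for k
  have C: "?C k \<in> sets M" for k
    using cylinder_sets[OF J] .
  have A: "A k \<in> sets M" for k
    unfolding A_def using C by auto
  have inv: "(override_on (fst x) r (J k), override_on (snd x) r' (J' k)) \<in> A k"
    if x: "x \<in> A k" and r: "\<And>i. i \<in> J k \<Longrightarrow> r i \<in> carrier (G i)" "\<And>i. i \<in> J' k \<Longrightarrow> r' i \<in> carrier (G' i)"
    for k x r r'
  proof -
    let ?y = "(override_on (fst x) r (J k), override_on (snd x) r' (J' k))"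
    have "?y \<in> space M"
      using x r J(1,2)[of k] unfolding A_def space_eq
      by (auto simp: override_on_def PiE_def extensional_def Pi_def)
    moreover have "?y \<notin> ?C i" if "i < k" for i
    proof
      assume y: "?y \<in> ?C i"
      have "J i \<inter> J k = {}" "J' i \<inter> J' k = {}"
        using disj that by (auto simp: disjoint_family_on_def)
      then have "x \<in> ?C i"
        using y x by (auto simp: cylinder_def A_def override_on_def split: if_splits)
      then show False
        using x that by (auto simp: A_def)
    qed
    ultimately show ?thesis
      by (auto simp: A_def)
  qed
  \<comment> \<open>The maximum with 1 guards the division and yields 0 \<le> c < 1 without a
    separate proof that \<open>N\<close> is positive.\<close>
  define c where "c = 1 - 1 / real (max 1 N)"
  have c: "0 \<le> c" "c < 1"
    by (auto simp: c_def max_def)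
  have step: "prob (A (Suc k)) \<le> c * prob (A k)" for k
  proof -
    have "prob (A k) \<le> real ((\<Prod>i\<in>J k. card (carrier (G i))) * (\<Prod>i\<in>J' k. card (carrier (G' i)))) * prob (A k \<inter> ?C k)"
      by (intro prob_le_card_mult_cylinder J fin p A inv)
    also have "\<dots> \<le> real (max 1 N) * prob (A k \<inter> ?C k)"
      using N[of k] by (intro mult_right_mono of_nat_mono) auto
    finally have "prob (A k) / real (max 1 N) \<le> prob (A k \<inter> ?C k)"
      by (simp add: divide_le_eq mult.commute)
    moreover have "A (Suc k) = A k - ?C k"
      by (auto simp: A_def less_Suc_eq)
    then have "prob (A (Suc k)) = prob (A k) - prob (A k \<inter> ?C k)"
      using A C by (simp add: finite_measure_Diff')
    ultimately show ?thesis
      by (simp add: c_def algebra_simps)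
  qed
  have pow: "prob (A k) \<le> c ^ k" for k
  proof (induction k)
    case (Suc k)
    then show ?case
      using step[of k] mult_left_mono[OF Suc c(1)] by simp
  qed simp
  define B where "B = space M - (\<Union>k. ?C k)"
  have B: "B \<in> sets M"
    unfolding B_def using C by auto
  have "prob B \<le> c ^ k" for k
  proof -
    have "prob B \<le> prob (A k)"
      using A by (intro finite_measure_mono) (auto simp: A_def B_def)
    with pow[of k] show ?thesis by simp
  qed
  moreover have "(\<lambda>k. c ^ k) \<longlonglongrightarrow> 0"
    using c by (intro LIMSEQ_realpow_zero)
  ultimately have "prob B \<le> 0"
    by (intro LIMSEQ_le_const) auto
  then have "B \<in> null_sets M"
    using B measure_nonneg[of M B] by (auto simp: null_sets_def emeasure_eq_measure)
  then show ?thesis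
    by (rule AE_I') (auto simp: B_def)
qed

end

subsection \<open>Random label vectors\<close>

lemma residues_power:
  assumes "2 \<le> l" "1 \<le> n"
  shows "residues (int l ^ n)"
  using assms by (intro residues.intro) (auto intro!: one_less_power)

lemma carrier_residues_mod_enat: "carrier (residues_mod l (enat n)) = {0..int l ^ n - 1}"
  by (simp add: residues_mod_def residue_ring_def)

lemma card_carrier_residues_mod_enat: "card (carrier (residues_mod l (enat n))) = l ^ n"
  by (simp add: carrier_residues_mod_enat nat_power_eq flip: of_nat_power)

lemma level_dataD:
  assumes "level_data V f v1 v2"
  shows "v1 \<in> V" "v2 \<in> V" "v1 \<noteq> v2" "f v1 = \<infinity>" "f v2 = \<infinity>"
    and "\<And>v. v \<in> V \<Longrightarrow> f v = \<infinity> \<longleftrightarrow> v = v1 \<or> v = v2"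
    and "\<And>v. v \<in> V \<Longrightarrow> v \<noteq> v1 \<Longrightarrow> v \<noteq> v2 \<Longrightarrow> \<exists>n\<ge>1. f v = enat n"
proof -
  have inf: "v \<in> V \<and> f v = \<infinity> \<longleftrightarrow> v = v1 \<or> v = v2" for v
    using assms by (simp add: level_data_def set_eq_iff)
  from inf[of v1] inf[of v2] show v12: "v1 \<in> V" "v2 \<in> V" "f v1 = \<infinity>" "f v2 = \<infinity>"
    by simp_all
  show *: "f v = \<infinity> \<longleftrightarrow> v = v1 \<or> v = v2" if "v \<in> V" for v
    using inf[of v] that by simp
  show "v1 \<noteq> v2"
    using assms by (simp add: level_data_def)
  fix v assume v: "v \<in> V" "v \<noteq> v1" "v \<noteq> v2"
  then have "1 \<le> f v" "f v \<noteq> \<infinity>"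
    using assms * by (auto simp: level_data_def)
  then show "\<exists>n\<ge>1. f v = enat n"
    by (cases "f v") (auto simp: one_enat_def)
qed

lemma group_vlabel_group:
  assumes "2 \<le> l" "level_data V f v1 v2" "v \<in> fin_verts V f"
  shows "group (vlabel_group l f v)"
proof -
  have "v \<in> V" "v \<noteq> v1" "v \<noteq> v2"
    using assms(3) level_dataD(4,5)[OF assms(2)] by (auto simp: fin_verts_def)
  then obtain n where n: "1 \<le> n" "f v = enat n"
    using level_dataD(7)[OF assms(2)] by blast
  interpret residues "int l ^ n" "residues_mod l (f v)"
    using residues_power[OF assms(1) n(1)] by (simp_all add: residues_mod_def n)
  show ?thesis
    unfolding vlabel_group_def by (rule units_group)
qed

text \<open>A free pair may start at \<open>v2\<close>, whose level is infinite, but it always ends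
  at a vertex of finite level. The minimum is thus finite and at least 1, and the modulus exceeds
  1.\<close>

lemma group_elabel_group:
  assumes "2 \<le> l" "level_data V f v1 v2" "p \<in> free_pairs V v1 v2"
  shows "group (elabel_group l f p)"
proof -
  obtain v w where p: "p = (v, w)"
    by (cases p)
  have vw: "v \<in> V" "w \<in> V" "w \<noteq> v1" "w \<noteq> v2"
    using assms(3) by (auto simp: p free_pairs_def)
  obtain m where m: "1 \<le> m" "f w = enat m"
    using level_dataD(7)[OF assms(2)] vw by blast
  have "1 \<le> f v"
    using assms(2) vw by (simp add: level_data_def)
  then have "\<exists>n\<ge>1. min (f v) (f w) = enat n"
    using m by (cases "f v") (auto simp: one_enat_def min_def)
  then obtain n where n: "1 \<le> n" "min (f v) (f w) = enat n"
    by blast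
  interpret residues "int l ^ n" "residues_mod l (min (f v) (f w))"
    using residues_power[OF assms(1) n(1)] by (simp_all add: residues_mod_def n)
  show ?thesis
    unfolding p elabel_group_def using a_group by (simp add: comm_group_def)
qed

lemma product_haar_label_group:
  assumes "2 \<le> l" "level_data V f v1 v2"
    and "normalized_haar_measure (label_group l V f v1 v2) (label_topology l V f v1 v2) M"
  shows "product_haar (fin_verts V f) (vlabel_group l f) (free_pairs V v1 v2) (elabel_group l f) M"
  using assms group_vlabel_group group_elabel_group
  by (intro product_haar.intro) (auto simp: label_group_def label_topology_def)

text \<open>The cylinders are those of infinitely many candidates \<open>w k\<close>: the label of
  \<open>w k\<close> together with the free labels joining it to \<open>S\<close>. The remaining
  labels between \<open>w k\<close> and \<open>S\<close> are fixed by the constraints and match the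
  prescription by \<open>log\<close> and \<open>zero\<close>; for the logarithm this uses that the
  label of \<open>w k\<close> is already \<alpha>.\<close>

lemma AE_ex_extension_vertex:
  assumes l: "2 \<le> l" and f: "level_data V f v1 v2"
    and inf: "infinite {v \<in> V. f v = enat n}" and n: "1 \<le> n"
    and M: "normalized_haar_measure (label_group l V f v1 v2) (label_topology l V f v1 v2) M"
    and S: "finite S" "S \<subseteq> V" "v1 \<in> S" "v2 \<in> S"
    and \<alpha>: "\<alpha> \<in> Units (residues_mod l (enat n))"
    and lam1: "\<And>s. s \<in> S \<Longrightarrow> lam1 s \<in> carrier (residues_mod l (min (enat n) (f s)))"
    and lam2: "\<And>s. s \<in> S \<Longrightarrow> lam2 s \<in> carrier (residues_mod l (min (enat n) (f s)))"
    and log: "lam2 v1 = log_label l L n \<alpha>" and zero: "lam1 v1 = 0" "lam1 v2 = 0"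
  shows "AE x in M. \<exists>v\<in>V - S. f v = enat n \<and> fst x v = \<alpha> \<and>
    (\<forall>s\<in>S. elabel (graph_of_labels l L V f v1 v2 x) (v, s) = lam1 s \<and>
            elabel (graph_of_labels l L V f v1 v2 x) (s, v) = lam2 s)"
proof -
  interpret product_haar "fin_verts V f" "vlabel_group l f" "free_pairs V v1 v2" "elabel_group l f" M
    using product_haar_label_group[OF l f M] .
  note f' = level_dataD[OF f]
  interpret R: residues "int l ^ n" "residues_mod l (enat n)"
    using residues_power[OF l n] by (simp_all add: residues_mod_def)
  have "infinite ({v \<in> V. f v = enat n} - S)"
    using inf S by simp
  then obtain w :: "nat \<Rightarrow> 'a" where w: "inj w" "range w \<subseteq> {v \<in> V. f v = enat n} - S"
    using infinite_countable_subset by blast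
  have wV: "w k \<in> V" "f (w k) = enat n" "w k \<notin> S" for k
    using w(2) by blast+
  have w12: "w k \<noteq> v1" "w k \<noteq> v2" for k
    using wV[of k] S by auto
  have w_eq: "w i = w j \<longleftrightarrow> i = j" for i j
    using w(1) by (auto dest: injD)
  \<comment> \<open>The only end of such a pair outside \<open>S\<close> is \<open>w k\<close>, so
    the sets for different \<open>k\<close> are disjoint. Labels between two candidates occur in
    none of them.\<close>
  define J' where "J' k = free_pairs V v1 v2 \<inter> ({w k} \<times> S \<union> S \<times> {w k})" for k
  \<comment> \<open>Exactly one end of a pair in \<open>J' k\<close> lies in \<open>S\<close>, so
    testing the second end reveals the direction, and a single function serves all
    \<open>k\<close>.\<close>
  define p' where "p' = (\<lambda>(a, b). if b \<in> S then lam1 b else lam2 a)"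
  have finJ': "finite (J' k)" for k
    using S by (auto simp: J'_def)
  have J'_level: "\<exists>s\<in>S. p' q = (if snd q \<in> S then lam1 s else lam2 s) \<and>
      carrier (elabel_group l f q) = carrier (residues_mod l (min (enat n) (f s)))"
    if "q \<in> J' k" for q k
    using that wV[of k] by (auto simp: J'_def p'_def elabel_group_def min.commute)
  have J'_card: "finite (carrier (elabel_group l f q)) \<and> card (carrier (elabel_group l f q)) \<le> l ^ n"
    if q: "q \<in> J' k" for q k
  proof -
    obtain s where s: "carrier (elabel_group l f q) = carrier (residues_mod l (min (enat n) (f s)))"
      using J'_level[OF q] by blast
    have "\<exists>m\<le>n. min (enat n) (f s) = enat m"
      by (cases "f s") (auto simp: min_def)
    then obtain m where "min (enat n) (f s) = enat m" "m \<le> n"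
      by blast
    then show ?thesis
      using s l by (simp add: card_carrier_residues_mod_enat) (simp add: carrier_residues_mod_enat)
  qed
  have vcarrier: "carrier (vlabel_group l f (w k)) = Units (residues_mod l (enat n))" for k
    by (simp add: vlabel_group_def units_of_def wV)
  have "AE x in M. \<exists>k. x \<in> cylinder {w k} (J' k) (\<lambda>_. \<alpha>) p'"
  proof (rule AE_ex_cylinder)
    show "{w k} \<subseteq> fin_verts V f" for k
      using wV by (auto simp: fin_verts_def)
    show "disjoint_family (\<lambda>k. {w k})" "disjoint_family J'"
      using wV w_eq by (auto simp: disjoint_family_on_def J'_def)
    show "finite (carrier (vlabel_group l f v))" "\<alpha> \<in> carrier (vlabel_group l f v)" if "v \<in> {w k}" for v k
      using that \<alpha> by (auto simp: vcarrier)
    show "p' q \<in> carrier (elabel_group l f q)" if "q \<in> J' k" for q k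
      using J'_level[OF that] lam1 lam2 by auto
    \<comment> \<open>One vertex label and at most 2|S| edge labels, each from a group of order at
      most l^n: the bound depends on \<open>n\<close> and \<open>S\<close> but not on
      \<open>k\<close>.\<close>
    show "(\<Prod>i\<in>{w k}. card (carrier (vlabel_group l f i))) * (\<Prod>i\<in>J' k. card (carrier (elabel_group l f i)))
        \<le> l ^ n * (l ^ n) ^ (card S + card S)" for k
    proof (intro mult_mono)
      have "card (Units (residues_mod l (enat n))) \<le> card (carrier (residues_mod l (enat n)))"
        by (intro card_mono) (auto simp: Units_def)
      then show "(\<Prod>i\<in>{w k}. card (carrier (vlabel_group l f i))) \<le> l ^ n"
        by (simp add: vcarrier card_carrier_residues_mod_enat)
      have "card (J' k) \<le> card ({w k} \<times> S \<union> S \<times> {w k})"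
        using S by (intro card_mono) (auto simp: J'_def)
      also have "\<dots> \<le> card S + card S"
        by (rule order_trans[OF card_Un_le]) (simp add: card_cartesian_product)
      finally have "(l ^ n) ^ card (J' k) \<le> (l ^ n) ^ (card S + card S)"
        using l by (intro power_increasing) auto
      moreover have "(\<Prod>i\<in>J' k. card (carrier (elabel_group l f i))) \<le> (\<Prod>i\<in>J' k. l ^ n)"
        using J'_card by (intro prod_mono) auto
      ultimately show "(\<Prod>i\<in>J' k. card (carrier (elabel_group l f i))) \<le> (l ^ n) ^ (card S + card S)"
        by simp
    qed auto
  qed (use finJ' J'_card in \<open>auto simp: J'_def\<close>)
  then show ?thesis
  proof eventually_elim
    case (elim x)
    then obtain k where x: "fst x (w k) = \<alpha>" "\<And>q. q \<in> J' k \<Longrightarrow> snd x q = p' q"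
      by (auto simp: cylinder_def)
    let ?E = "elabel (graph_of_labels l L V f v1 v2 x)"
    have "?E (w k, s) = lam1 s \<and> ?E (s, w k) = lam2 s" if s: "s \<in> S" for s
    proof
      have sw: "s \<in> V" "s \<noteq> w k"
        using s S wV by auto
      show "?E (w k, s) = lam1 s"
        using x(2)[of "(w k, s)"] s sw wV w12 zero
        by (auto simp: graph_of_labels_def label_pairs_def J'_def p'_def free_pairs_def)
      show "?E (s, w k) = lam2 s"
        using x(1) x(2)[of "(s, w k)"] s sw wV w12 log
        by (auto simp: graph_of_labels_def label_pairs_def J'_def p'_def free_pairs_def)
    qed
    then show ?case
      using wV x by blast
  qed
qed

lemma AE_is_rado:
  assumes l: "2 \<le> l" and L: "ladic_log l L" and f: "level_data V f v1 v2"
    and inf: "\<And>n. 1 \<le> n \<Longrightarrow> infinite {v \<in> V. f v = enat n}"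
    and M: "normalized_haar_measure (label_group l V f v1 v2) (label_topology l V f v1 v2) M"
  shows "AE x in M. is_rado l L (graph_of_labels l L V f v1 v2 x)"
proof -
  define hyp where "hyp S n \<alpha> lam1 lam2 \<longleftrightarrow> v1 \<in> S \<and> v2 \<in> S \<and> 1 \<le> n \<and>
      \<alpha> \<in> Units (residues_mod l (enat n)) \<and>
      (\<forall>s\<in>S. lam1 s \<in> carrier (residues_mod l (min (enat n) (f s))) \<and>
              lam2 s \<in> carrier (residues_mod l (min (enat n) (f s)))) \<and>
      lam2 v1 = log_label l L n \<alpha> \<and> lam1 v1 = 0 \<and> lam1 v2 = 0" for S n \<alpha> and lam1 lam2 :: "'a \<Rightarrow> int"
  define ext where "ext x S n \<alpha> lam1 lam2 \<longleftrightarrow> (\<exists>v\<in>V - S. f v = enat n \<and> fst x v = \<alpha> \<and>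
    (\<forall>s\<in>S. elabel (graph_of_labels l L V f v1 v2 x) (v, s) = lam1 s \<and>
            elabel (graph_of_labels l L V f v1 v2 x) (s, v) = lam2 s))"
    for x S n \<alpha> and lam1 lam2 :: "'a \<Rightarrow> int"
  \<comment> \<open>There are uncountably many functions on all vertices, but only the values of
    \<open>lam1\<close> and \<open>lam2\<close> on \<open>S\<close> matter. Ranging over functions
    that are extensional on the finite set \<open>S\<close> leaves countably many conditions;
    arbitrary prescriptions are recovered by restriction.\<close>
  let ?F = "{S. S \<subseteq> V \<and> finite S}" and ?\<Lambda> = "\<lambda>S. S \<rightarrow>\<^sub>E (UNIV :: int set)"
  have F: "countable ?F"
    using f by (simp add: level_data_def conj_commute countable_Collect_finite_subset)
  have \<Lambda>: "countable (?\<Lambda> S)" if "S \<in> ?F" for S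
    using that by (intro countable_PiE) auto
  have ext: "AE x in M. hyp S n \<alpha> lam1 lam2 \<longrightarrow> ext x S n \<alpha> lam1 lam2" if "S \<in> ?F" for S n \<alpha> lam1 lam2
    using that AE_ex_extension_vertex[OF l f inf _ M, of n S \<alpha> lam1 lam2 L]
    by (cases "hyp S n \<alpha> lam1 lam2") (auto simp: hyp_def ext_def)
  have "AE x in M. \<forall>S\<in>?F. \<forall>n \<alpha>. \<forall>lam1\<in>?\<Lambda> S. \<forall>lam2\<in>?\<Lambda> S. hyp S n \<alpha> lam1 lam2 \<longrightarrow> ext x S n \<alpha> lam1 lam2"
    using ext
    \<comment> \<open>The congruence rule makes the membership of \<open>S\<close> in
      \<open>?F\<close> available, on which the countability of \<open>?\<Lambda> S\<close>
      rests.\<close>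
    by (simp only: AE_ball_countable[OF F] AE_ball_countable[OF \<Lambda>] AE_all_countable cong: ball_cong) blast
  moreover have "AE x in M. x \<in> carrier (label_group l V f v1 v2)"
    using M by (intro AE_I2) (simp add: normalized_haar_measure_def label_topology_def label_group_def DirProd_def)
  ultimately show ?thesis
  proof eventually_elim
    case (elim x)
    let ?G = "graph_of_labels l L V f v1 v2 x"
    have G: "verts ?G = V" "level ?G = f" "vinf1 ?G = v1" "vinf2 ?G = v2" "vlabel ?G = fst x"
      by (simp_all add: graph_of_labels_def)
    have "is_decorated_graph l L ?G"
      using bij_betw_imp_surj_on[OF bij_betw_graph_of_labels[OF l L f]] elim(2) by auto
    moreover have "ext x S n \<alpha> lam1 lam2" if S: "finite S" "S \<subseteq> V" and h: "hyp S n \<alpha> lam1 lam2" for S n \<alpha> lam1 lam2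
    proof -
      have "hyp S n \<alpha> (restrict lam1 S) (restrict lam2 S)"
        using h by (auto simp: hyp_def)
      then have "ext x S n \<alpha> (restrict lam1 S) (restrict lam2 S)"
        using S elim(1) by auto
      then show ?thesis
        by (auto simp: ext_def)
    qed
    ultimately show "is_rado l L ?G"
      by (simp add: is_rado_def G hyp_def ext_def)
  qed
qed

subsection \<open>Back and forth\<close>

text \<open>A relation instead of a function makes the notion symmetric in the two graphs and lets
  the limit be a plain union. Both infinite vertices are included from the start because the Rado
  property speaks only of finite sets that contain them. Between these two no edge label exists,
  hence the condition on levels.\<close>

definition partial_isomorphism :: "'v decorated_graph \<Rightarrow> 'w decorated_graph \<Rightarrow> ('v \<times> 'w) set \<Rightarrow> bool" where
  "partial_isomorphism G H R \<longleftrightarrow>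
     R \<subseteq> verts G \<times> verts H \<and> (vinf1 G, vinf1 H) \<in> R \<and> (vinf2 G, vinf2 H) \<in> R \<and>
     (\<forall>(a, a')\<in>R. level H a' = level G a \<and> (level G a \<noteq> \<infinity> \<longrightarrow> vlabel H a' = vlabel G a)) \<and>
     (\<forall>(a, a')\<in>R. \<forall>(b, b')\<in>R. (a = b \<longleftrightarrow> a' = b') \<and>
        (a \<noteq> b \<and> (level G a \<noteq> \<infinity> \<or> level G b \<noteq> \<infinity>) \<longrightarrow> elabel H (a', b') = elabel G (a, b)))"

lemma partial_isomorphismD:
  assumes "partial_isomorphism G H R" "(a, a') \<in> R"
  shows "a \<in> verts G" "a' \<in> verts H" "level H a' = level G a"
    and "level G a \<noteq> \<infinity> \<Longrightarrow> vlabel H a' = vlabel G a"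
    and "(b, b') \<in> R \<Longrightarrow> a = b \<longleftrightarrow> a' = b'"
    and "(b, b') \<in> R \<Longrightarrow> a \<noteq> b \<Longrightarrow> level G a \<noteq> \<infinity> \<or> level G b \<noteq> \<infinity> \<Longrightarrow> elabel H (a', b') = elabel G (a, b)"
  using assms unfolding partial_isomorphism_def by fast+

lemma partial_isomorphismI:
  assumes "\<And>a a'. (a, a') \<in> R \<Longrightarrow> a \<in> verts G \<and> a' \<in> verts H \<and> level H a' = level G a \<and>
      (level G a \<noteq> \<infinity> \<longrightarrow> vlabel H a' = vlabel G a)"
    and "(vinf1 G, vinf1 H) \<in> R" "(vinf2 G, vinf2 H) \<in> R"
    and "\<And>a a' b b'. (a, a') \<in> R \<Longrightarrow> (b, b') \<in> R \<Longrightarrow> (a = b \<longleftrightarrow> a' = b') \<and>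
      (a \<noteq> b \<and> (level G a \<noteq> \<infinity> \<or> level G b \<noteq> \<infinity>) \<longrightarrow> elabel H (a', b') = elabel G (a, b))"
  shows "partial_isomorphism G H R"
  unfolding partial_isomorphism_def
  by (intro conjI ballI subsetI; clarify?) (use assms in simp_all)

text \<open>This turns the back step into a forth step with the graphs exchanged. The conditions on
  levels carry over since related vertices have equal level.\<close>

lemma partial_isomorphism_converse:
  assumes R: "partial_isomorphism G H R"
  shows "partial_isomorphism H G (R\<inverse>)"
proof (rule partial_isomorphismI)
  fix a a' assume "(a, a') \<in> R\<inverse>"
  then show "a \<in> verts H \<and> a' \<in> verts G \<and> level G a' = level H a \<and>
      (level H a \<noteq> \<infinity> \<longrightarrow> vlabel G a' = vlabel H a)"
    using partial_isomorphismD(1-4)[OF R, of a' a] by simp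
next
  fix a a' b b' assume "(a, a') \<in> R\<inverse>" "(b, b') \<in> R\<inverse>"
  then show "(a = b \<longleftrightarrow> a' = b') \<and>
      (a \<noteq> b \<and> (level H a \<noteq> \<infinity> \<or> level H b \<noteq> \<infinity>) \<longrightarrow> elabel G (a', b') = elabel H (a, b))"
    using partial_isomorphismD(3)[OF R, of a' a] partial_isomorphismD(3)[OF R, of b' b]
      partial_isomorphismD(5,6)[OF R, of a' a b' b] by auto
qed (use R in \<open>simp_all add: partial_isomorphism_def\<close>)

text \<open>Each condition involves at most two pairs, and along an increasing sequence any two
  pairs of the union already occur at a common stage.\<close>

lemma partial_isomorphism_Union:
  assumes "incseq R" "\<And>n. partial_isomorphism G H (R n)"
  shows "partial_isomorphism G H (\<Union>n. R n)"
proof -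
  have "\<exists>n. p \<in> R n \<and> q \<in> R n" if "p \<in> (\<Union>n. R n)" "q \<in> (\<Union>n. R n)" for p q
  proof -
    obtain i j where "p \<in> R i" "q \<in> R j"
      using \<open>p \<in> (\<Union>n. R n)\<close> \<open>q \<in> (\<Union>n. R n)\<close> by blast
    then show ?thesis
      using incseqD[OF assms(1), of i "max i j"] incseqD[OF assms(1), of j "max i j"] by auto
  qed
  note * = this
  show ?thesis
  proof (rule partial_isomorphismI)
    fix a a' assume "(a, a') \<in> (\<Union>n. R n)"
    then obtain n where "(a, a') \<in> R n"
      by blast
    from partial_isomorphismD(1-4)[OF assms(2) this]
    show "a \<in> verts G \<and> a' \<in> verts H \<and> level H a' = level G a \<and>
        (level G a \<noteq> \<infinity> \<longrightarrow> vlabel H a' = vlabel G a)"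
      by simp
  next
    fix a a' b b' assume "(a, a') \<in> (\<Union>n. R n)" "(b, b') \<in> (\<Union>n. R n)"
    then obtain n where n: "(a, a') \<in> R n" "(b, b') \<in> R n"
      using * by blast
    show "(a = b \<longleftrightarrow> a' = b') \<and>
        (a \<noteq> b \<and> (level G a \<noteq> \<infinity> \<or> level G b \<noteq> \<infinity>) \<longrightarrow> elabel H (a', b') = elabel G (a, b))"
      using partial_isomorphismD(5,6)[OF assms(2) n(1) n(2)] by simp
  qed (use assms(2) in \<open>auto simp: partial_isomorphism_def\<close>)
qed

lemma partial_isomorphism_vinf:
  assumes "level_data (verts G) (level G) (vinf1 G) (vinf2 G)"
    and "level_data (verts H) (level H) (vinf1 H) (vinf2 H)"
  shows "partial_isomorphism G H {(vinf1 G, vinf1 H), (vinf2 G, vinf2 H)}"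
proof -
  have "vinf1 G \<in> verts G" "vinf2 G \<in> verts G" "level G (vinf1 G) = \<infinity>" "level G (vinf2 G) = \<infinity>"
    "vinf1 H \<in> verts H" "vinf2 H \<in> verts H" "level H (vinf1 H) = \<infinity>" "level H (vinf2 H) = \<infinity>"
    "vinf1 G \<noteq> vinf2 G" "vinf1 H \<noteq> vinf2 H"
    using assms unfolding level_data_def by blast+
  then show ?thesis
    by (auto simp: partial_isomorphism_def)
qed

text \<open>The image \<open>v'\<close> of a new vertex \<open>v\<close> comes from the Rado
  property of \<open>H\<close> with the range of \<open>R\<close> as finite set, the level and label
  of \<open>v\<close>, and the edge labels of \<open>v\<close> pulled back along
  \<open>R\<close>.\<close>

lemma partial_isomorphism_forth:
  assumes G: "is_decorated_graph l L G" and H: "is_rado l L H"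
    and R: "finite R" "partial_isomorphism G H R" and v: "v \<in> verts G"
  shows "\<exists>v'. partial_isomorphism G H (insert (v, v') R)"
proof (cases "v \<in> Domain R")
  case True
  then show ?thesis
    using R(2) by (metis Domain.cases insert_absorb)
next
  case False
  note RD = partial_isomorphismD[OF R(2)]
  have vinf: "(vinf1 G, vinf1 H) \<in> R" "(vinf2 G, vinf2 H) \<in> R"
    using R(2) by (auto simp: partial_isomorphism_def)
  then have v12: "v \<noteq> vinf1 G" "v \<noteq> vinf2 G"
    using False by auto
  have data: "level_data (verts G) (level G) (vinf1 G) (vinf2 G)"
    using G by (simp add: is_decorated_graph_def)
  then have lv: "level G v \<noteq> \<infinity>" "1 \<le> level G v"
    using v v12 by (auto simp: level_data_def)
  then obtain n where n: "level G v = enat n" "1 \<le> n"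
    by (cases "level G v") (auto simp: one_enat_def)
  have vfin: "v \<in> fin_verts (verts G) (level G)"
    using v lv by (simp add: fin_verts_def)
  have "\<exists>a. (a, s) \<in> R" if "s \<in> Range R" for s
    using that by blast
  then obtain r where r: "\<And>s. s \<in> Range R \<Longrightarrow> (r s, s) \<in> R"
    by metis
  have r_eq: "r a' = a" if "(a, a') \<in> R" for a a'
    using RD(5)[OF r that] that by blast
  have lab: "elabel G (a, b) \<in> carrier (residues_mod l (min (level G a) (level G b)))"
    if "(a, b) \<in> label_pairs (verts G) (vinf1 G) (vinf2 G)" for a b
    using G that by (auto simp: is_decorated_graph_def PiE_def Pi_def)
  have lab': "elabel G (v, r s) \<in> carrier (residues_mod l (min (enat n) (level H s))) \<and>
      elabel G (r s, v) \<in> carrier (residues_mod l (min (enat n) (level H s)))" if "s \<in> Range R" for s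
  proof -
    have "r s \<in> verts G" "r s \<noteq> v" "level H s = level G (r s)"
      using RD(1,3)[OF r[OF that]] r[OF that] False by auto
    then show ?thesis
      using lab[of v "r s"] lab[of "r s" v] v v12 n by (auto simp: label_pairs_def min.commute)
  qed
  have "vlabel G v \<in> Units (residues_mod l (level G v))"
    using G vfin by (auto simp: is_decorated_graph_def PiE_def Pi_def)
  then have \<alpha>: "vlabel G v \<in> Units (residues_mod l (enat n))"
    by (simp add: n)
  \<comment> \<open>These are the side conditions of the Rado property of \<open>H\<close>:
    \<open>r\<close> sends the infinite vertices of \<open>H\<close> to those of \<open>G\<close>,
    and the logarithm is the same for both graphs.\<close>
  have spec: "elabel G (vinf1 G, v) = log_label l L n (vlabel G v)"
    "elabel G (v, vinf1 G) = 0" "elabel G (v, vinf2 G) = 0"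
    using G vfin n by (auto simp: is_decorated_graph_def)
  have S: "finite (Range R)" "Range R \<subseteq> verts H" "{vinf1 H, vinf2 H} \<subseteq> Range R"
    using R(1) RD(2) vinf by (auto simp: finite_Range)
  obtain v' where v': "v' \<in> verts H - Range R" "level H v' = enat n" "vlabel H v' = vlabel G v"
    "\<And>s. s \<in> Range R \<Longrightarrow> elabel H (v', s) = elabel G (v, r s) \<and> elabel H (s, v') = elabel G (r s, v)"
  proof -
    have "\<exists>v'\<in>verts H - Range R. level H v' = enat n \<and> vlabel H v' = vlabel G v \<and>
        (\<forall>s\<in>Range R. elabel H (v', s) = elabel G (v, r s) \<and> elabel H (s, v') = elabel G (r s, v))"
      using H S n(2) \<alpha> lab' spec r_eq[OF vinf(1)] r_eq[OF vinf(2)]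
      unfolding is_rado_def
      by (elim conjE allE[where x = "Range R"] allE[where x = n] allE[where x = "vlabel G v"]
          allE[where x = "\<lambda>s. elabel G (v, r s)"] allE[where x = "\<lambda>s. elabel G (r s, v)"]) simp
    then show ?thesis
      using that by blast
  qed
  have new: "a \<noteq> v \<and> a' \<noteq> v' \<and> elabel H (v', a') = elabel G (v, a) \<and> elabel H (a', v') = elabel G (a, v)"
    if "(a, a') \<in> R" for a a'
    using v'(1) v'(4)[of a'] r_eq[OF that] that False by auto
  have "partial_isomorphism G H (insert (v, v') R)"
  proof (rule partial_isomorphismI)
    fix a a' assume "(a, a') \<in> insert (v, v') R"
    then show "a \<in> verts G \<and> a' \<in> verts H \<and> level H a' = level G a \<and>
        (level G a \<noteq> \<infinity> \<longrightarrow> vlabel H a' = vlabel G a)"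
      using v v' n RD(1-4) by auto
  next
    fix a a' b b' assume "(a, a') \<in> insert (v, v') R" "(b, b') \<in> insert (v, v') R"
    then consider "a = v" "a' = v'" "b = v" "b' = v'" | "a = v" "a' = v'" "(b, b') \<in> R"
      | "b = v" "b' = v'" "(a, a') \<in> R" | "(a, a') \<in> R" "(b, b') \<in> R"
      by blast
    then show "(a = b \<longleftrightarrow> a' = b') \<and>
        (a \<noteq> b \<and> (level G a \<noteq> \<infinity> \<or> level G b \<noteq> \<infinity>) \<longrightarrow> elabel H (a', b') = elabel G (a, b))"
    proof cases
      case 2
      then show ?thesis using new[of b b'] by auto
    next
      case 3
      then show ?thesis using new[of a a'] by auto
    next
      case 4
      then show ?thesis using RD(5,6)[of a a' b b'] by simp
    qed simp
  qed (use vinf in simp_all)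
  then show ?thesis ..
qed

text \<open>Matching equality on both sides makes a total relation the graph of a bijection.
  \<open>label_pairs\<close> leaves out just the pairs of infinite vertices, on which a partial
  isomorphism imposes no edge condition.\<close>

lemma partial_isomorphism_total_imp_isomorphic:
  assumes R: "partial_isomorphism G H R" and tot: "Domain R = verts G" "Range R = verts H"
    and G: "level_data (verts G) (level G) (vinf1 G) (vinf2 G)"
  shows "decorated_graph_isomorphic G H"
proof -
  note RD = partial_isomorphismD[OF R]
  have "\<exists>b. (a, b) \<in> R" if "a \<in> verts G" for a
    using that tot by blast
  then obtain \<phi> where \<phi>: "\<And>a. a \<in> verts G \<Longrightarrow> (a, \<phi> a) \<in> R"
    by metis
  have "inj_on \<phi> (verts G)"
    using RD(5)[OF \<phi> \<phi>] by (auto intro!: inj_onI)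
  moreover have "\<phi> ` verts G = verts H"
  proof
    show "\<phi> ` verts G \<subseteq> verts H"
      using RD(2)[OF \<phi>] by blast
    show "verts H \<subseteq> \<phi> ` verts G"
    proof
      fix b assume "b \<in> verts H"
      then obtain a where a: "(a, b) \<in> R"
        using tot by blast
      then have "b = \<phi> a"
        using RD(5)[OF a \<phi>] RD(1)[OF a] by blast
      then show "b \<in> \<phi> ` verts G"
        using RD(1)[OF a] by blast
    qed
  qed
  ultimately have "bij_betw \<phi> (verts G) (verts H)"
    by (simp add: bij_betw_def)
  moreover have "elabel H (\<phi> a, \<phi> b) = elabel G (a, b)"
    if "(a, b) \<in> label_pairs (verts G) (vinf1 G) (vinf2 G)" for a b
    using that RD(6)[OF \<phi> \<phi>, of a b] level_dataD(6)[OF G, of a] level_dataD(6)[OF G, of b]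
    by (auto simp: label_pairs_def)
  ultimately show ?thesis
    unfolding decorated_graph_isomorphic_def fin_verts_def using RD(3,4)[OF \<phi>] by blast
qed

lemma is_rado_imp_isomorphic:
  assumes G: "is_rado l L G" and H: "is_rado l L H"
  shows "decorated_graph_isomorphic G H"
proof -
  have G': "is_decorated_graph l L G" and H': "is_decorated_graph l L H"
    using G H by (simp_all add: is_rado_def)
  have dG: "level_data (verts G) (level G) (vinf1 G) (vinf2 G)"
    and dH: "level_data (verts H) (level H) (vinf1 H) (vinf2 H)"
    using G' H' by (simp_all add: is_decorated_graph_def)
  have ne: "verts G \<noteq> {}" "verts H \<noteq> {}" and count: "countable (verts G)" "countable (verts H)"
    using dG dH by (auto simp: level_data_def)
  let ?P = "\<lambda>R. finite R \<and> partial_isomorphism G H R"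
  \<comment> \<open>Stage n + 1 absorbs the n-th vertex of each graph; stage 0 is only required to
    be a finite partial isomorphism.\<close>
  have "\<exists>R. \<forall>n. ?P (R n) \<and> (R n \<subseteq> R (Suc n) \<and>
      from_nat_into (verts G) n \<in> Domain (R (Suc n)) \<and> from_nat_into (verts H) n \<in> Range (R (Suc n)))"
  proof (rule dependent_nat_choice)
    show "\<exists>R. ?P R"
      using partial_isomorphism_vinf[OF dG dH] by (meson finite.emptyI finite_insert)
  next
    fix R n assume R: "?P R"
    obtain b where b: "partial_isomorphism G H (insert (from_nat_into (verts G) n, b) R)"
      using partial_isomorphism_forth[OF G' H _ _ from_nat_into[OF ne(1)]] R by blast
    let ?R = "insert (from_nat_into (verts G) n, b) R"
    obtain a where "partial_isomorphism H G (insert (from_nat_into (verts H) n, a) (?R\<inverse>))"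
      using partial_isomorphism_forth[OF H' G _ partial_isomorphism_converse[OF b] from_nat_into[OF ne(2)]] R
      by auto
    moreover have "(insert (from_nat_into (verts H) n, a) (?R\<inverse>))\<inverse> = insert (a, from_nat_into (verts H) n) ?R"
      by auto
    ultimately have "partial_isomorphism G H (insert (a, from_nat_into (verts H) n) ?R)"
      using partial_isomorphism_converse by metis
    then show "\<exists>R'. ?P R' \<and> (R \<subseteq> R' \<and>
        from_nat_into (verts G) n \<in> Domain R' \<and> from_nat_into (verts H) n \<in> Range R')"
      using R by (intro exI[of _ "insert (a, from_nat_into (verts H) n) ?R"]) auto
  qed
  then obtain R where R: "\<And>n. partial_isomorphism G H (R n)" "\<And>n. R n \<subseteq> R (Suc n)"
    "\<And>n. from_nat_into (verts G) n \<in> Domain (R (Suc n))" "\<And>n. from_nat_into (verts H) n \<in> Range (R (Suc n))"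
    by blast
  let ?U = "\<Union>n. R n"
  have U: "partial_isomorphism G H ?U"
    using R by (intro partial_isomorphism_Union incseq_SucI)
  have "verts G \<subseteq> Domain ?U"
  proof
    fix v assume "v \<in> verts G"
    then obtain n where "from_nat_into (verts G) n = v"
      using from_nat_into_surj[OF count(1)] by blast
    then show "v \<in> Domain ?U"
      using R(3)[of n] by blast
  qed
  moreover have "verts H \<subseteq> Range ?U"
  proof
    fix v assume "v \<in> verts H"
    then obtain n where "from_nat_into (verts H) n = v"
      using from_nat_into_surj[OF count(2)] by blast
    then show "v \<in> Range ?U"
      using R(4)[of n] by blast
  qed
  moreover have "?U \<subseteq> verts G \<times> verts H"
    using U by (simp add: partial_isomorphism_def)
  ultimately have "Domain ?U = verts G" "Range ?U = verts H"
    by blast+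
  then show ?thesis
    by (rule partial_isomorphism_total_imp_isomorphic[OF U _ _ dG])
qed

theorem theorem2p8:
  fixes l :: nat and L :: "ladic \<Rightarrow> ladic"
    and V :: "'v set" and f :: "'v \<Rightarrow> enat" and v1 v2 :: 'v
    and M :: "(('v \<Rightarrow> int) \<times> ('v \<times> 'v \<Rightarrow> int)) measure"
  assumes "prime l" and "odd l" and "ladic_log l L"
    and "level_data V f v1 v2"
    and "\<And>n. 1 \<le> n \<Longrightarrow> infinite {v \<in> V. f v = enat n}"
    and "normalized_haar_measure (label_group l V f v1 v2) (label_topology l V f v1 v2) M"
  shows "(AE x in M. is_rado l L (graph_of_labels l L V f v1 v2 x)) \<and>
    (AE (x, y) in M \<Otimes>\<^sub>M M. decorated_graph_isomorphic
       (graph_of_labels l L V f v1 v2 x) (graph_of_labels l L V f v1 v2 y))"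
proof
  have l: "2 \<le> l"
    using assms(1) by (rule prime_ge_2_nat)
  let ?\<Gamma> = "graph_of_labels l L V f v1 v2"
  show rado: "AE x in M. is_rado l L (?\<Gamma> x)"
    using AE_is_rado[OF l assms(3-6)] .
  interpret product_haar "fin_verts V f" "vlabel_group l f" "free_pairs V v1 v2" "elabel_group l f" M
    using product_haar_label_group[OF l assms(4,6)] .
  obtain N where N: "{x \<in> space M. \<not> is_rado l L (?\<Gamma> x)} \<subseteq> N" "N \<in> null_sets M"
    using rado by (auto simp: eventually_ae_filter)
  \<comment> \<open>No measurability is claimed for the set of non-isomorphic pairs. It is enclosed
    in this null set, outside of which both graphs are Rado.\<close>
  have "N \<times> space M \<union> space M \<times> N \<in> null_sets (M \<Otimes>\<^sub>M M)"
    using N by (intro null_sets.Un times_in_null_sets1 times_in_null_sets2) auto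
  then show "AE (x, y) in M \<Otimes>\<^sub>M M. decorated_graph_isomorphic (?\<Gamma> x) (?\<Gamma> y)"
  proof (rule AE_I')
    have "decorated_graph_isomorphic (?\<Gamma> x) (?\<Gamma> y)"
      if "x \<in> space M - N" "y \<in> space M - N" for x y
      using that N by (intro is_rado_imp_isomorphic[of l L]) blast+
    then show "{p \<in> space (M \<Otimes>\<^sub>M M). \<not> (case p of (x, y) \<Rightarrow>
        decorated_graph_isomorphic (?\<Gamma> x) (?\<Gamma> y))} \<subseteq> N \<times> space M \<union> space M \<times> N"
      by (force simp: space_pair_measure)
  qed
qed

end
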